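(* Let $X$ be a nonempty locally compact Hausdorff space and let $Y$ be a locally convex topological vector space over $\mathbb{R}$ or $\mathbb{C}$ with at least two points, equipped with a compatible metric $d$. The following assertions are equivalent: (1) $MC(X,Y)$ is metrizable; (2) $MC(X,Y)$ is first countable; (3) $MC(X,Y)$ is Fréchet-Urysohn; (4) $MC(X,Y)$ is sequential; (5) $MC(X,Y)$ has countable tightness; (6) $X$ is hemicompact.
   Context: A map (multifunction) $F\colon X\to Y$ assigns to each $x\in X$ a subset $F(x)\subseteq Y$; for $A\subseteq X$ put $F(A)=\bigcup_{x\in A}F(x)$. Maps are identified with their graphs $\{(x,y): y\in F(x)\}$. $F$ is upper semicontinuous if for every $x\in X$ and every open $V\supseteq F(x)$ there is an open $U\ni x$ with $F(U)\subseteq V$. $F$ is usco if it is upper semicontinuous and every $F(x)$ is a nonempty compact set. $F$ is cusco if it is usco and every $F(x)$ is convex. $F$ is minimal cusco if it is cusco and its graph does not properly contain the graph of any other cusco map from $X$ to $Y$. $MC(X,Y)$ is the set of all minimal cusco maps from $X$ to $Y$. Let $K(Y)$ be the set of nonempty compact subsets of $Y$, and $H_d$ the Hausdorff metric on $K(Y)$. On $K(Y)^X$ the topology $\tau_{uc}$ of uniform convergence on compact sets is induced by the uniformity $\mathcal U_{uc}$ with base consisting of the sets $W[K,\varepsilon]=\{(F,G): H_d(F(x),G(x))<\varepsilon \text{ for every } x\in K\}$, where $K\subseteq X$ is compact and $\varepsilon>0$. $MC(X,Y)\subseteq K(Y)^X$ carries the subspace topology of $\tau_{uc}$. A space $Z$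 is: Fréchet-Urysohn if for every $E\subseteq Z$ and $z\in\overline{E}$ there is a sequence in $E$ converging to $z$; sequential if for every non-closed $A\subseteq Z$ there is a convergent sequence in $A$ whose limit is not in $A$; of countable tightness if for every $A\subseteq Z$ and $z\in\overline{A}$ there is a countable $A_0\subseteq A$ with $z\in\overline{A_0}$; hemicompact if the family $K(Z)$ of nonempty compact subsets of $Z$, ordered by inclusion, has a countable cofinal subfamily. *)

theory Defs
  imports "HOL-Analysis.Analysis"
begin

section \<open>Locally convex topological vector spaces\<close>

text \<open>
  The scalar field is a type of class \<^class>\<open>real_normed_field\<close>; by the Gelfand--Mazur theorem these
  are exactly the reals and the complex numbers, so one locale covers both cases.  The library
  notion \<^const>\<open>convex\<close> refers to the real scaling of the class \<^class>\<open>real_vector\<close>, which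
  \<open>scale_of_real\<close> requires to be the restriction of the given scaling.
\<close>

locale locally_convex_tvs = vector_space scale
  for scale :: "'k::real_normed_field \<Rightarrow> 'y::{real_vector,topological_space} \<Rightarrow> 'y" +
  assumes scale_of_real: "scale (of_real r) y = r *\<^sub>R y"
    and continuous_add: "continuous_on UNIV (\<lambda>(x::'y, y). x + y)"
    and continuous_scale: "continuous_on UNIV (\<lambda>(c, y). scale c y)"
    and locally_convex:
      "\<And>U::'y set. open U \<Longrightarrow> 0 \<in> U \<Longrightarrow> \<exists>V C. open V \<and> convex C \<and> 0 \<in> V \<and> V \<subseteq> C \<and> C \<subseteq> U"


section \<open>Minimal cusco maps\<close>

text \<open>
  A multifunction is a set-valued function of which only the values on \<^term>\<open>topspace X\<close> matter;
  its graph is \<^term>\<open>Sigma (topspace X) F\<close>.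
\<close>

definition upper_semicontinuous ::
    "'x topology \<Rightarrow> ('x \<Rightarrow> 'y::topological_space set) \<Rightarrow> bool" where
  "upper_semicontinuous X F \<longleftrightarrow>
     (\<forall>x\<in>topspace X. \<forall>V. open V \<and> F x \<subseteq> V \<longrightarrow>
        (\<exists>U. openin X U \<and> x \<in> U \<and> (\<Union>u\<in>U. F u) \<subseteq> V))"

definition usco :: "'x topology \<Rightarrow> ('x \<Rightarrow> 'y::topological_space set) \<Rightarrow> bool" where
  "usco X F \<longleftrightarrow> upper_semicontinuous X F \<and> (\<forall>x\<in>topspace X. F x \<noteq> {} \<and> compact (F x))"

definition cusco ::
    "'x topology \<Rightarrow> ('x \<Rightarrow> 'y::{real_vector,topological_space} set) \<Rightarrow> bool" where
  "cusco X F \<longleftrightarrow> usco X F \<and> (\<forall>x\<in>topspace X. convex (F x))"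

definition minimal_cusco ::
    "'x topology \<Rightarrow> ('x \<Rightarrow> 'y::{real_vector,topological_space} set) \<Rightarrow> bool" where
  "minimal_cusco X F \<longleftrightarrow>
     cusco X F \<and> \<not> (\<exists>G. cusco X G \<and> Sigma (topspace X) G \<subset> Sigma (topspace X) F)"

text \<open>
  Extensionality makes two members equal as soon as they have the same graph.
\<close>

definition MC :: "'x topology \<Rightarrow> ('x \<Rightarrow> 'y::{real_vector,topological_space} set) set" where
  "MC X = {F \<in> extensional (topspace X). minimal_cusco X F}"


section \<open>Uniform convergence on compact sets\<close>

definition hausdorff_dist :: "'y::metric_space set \<Rightarrow> 'y set \<Rightarrow> real" where
  "hausdorff_dist A B = max (SUP a\<in>A. infdist a B) (SUP b\<in>B. infdist b A)"

definition compact_valued :: "'x topology \<Rightarrow> ('x \<Rightarrow> 'y::topological_space set) set" where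
  "compact_valued X = (\<Pi>\<^sub>E x\<in>topspace X. {A. A \<noteq> {} \<and> compact A})"

definition uc_entourage ::
    "'x topology \<Rightarrow> 'x set \<Rightarrow> real \<Rightarrow>
      (('x \<Rightarrow> 'y::metric_space set) \<times> ('x \<Rightarrow> 'y set)) set" where
  "uc_entourage X K \<epsilon> =
     {(F, G). F \<in> compact_valued X \<and> G \<in> compact_valued X \<and>
        (\<forall>x\<in>K. hausdorff_dist (F x) (G x) < \<epsilon>)}"

definition uc_topology :: "'x topology \<Rightarrow> ('x \<Rightarrow> 'y::metric_space set) topology" where
  "uc_topology X = topology (\<lambda>\<U>. \<U> \<subseteq> compact_valued X \<and>
     (\<forall>F\<in>\<U>. \<exists>K \<epsilon>. compactin X K \<and> \<epsilon> > 0 \<and> uc_entourage X K \<epsilon> `` {F} \<subseteq> \<U>))"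

lemma openin_uc_topology:
  fixes X :: "'x topology" and \<U> :: "('x \<Rightarrow> 'y::metric_space set) set"
  shows "openin (uc_topology X) \<U> \<longleftrightarrow> \<U> \<subseteq> compact_valued X \<and>
     (\<forall>F\<in>\<U>. \<exists>K \<epsilon>. compactin X K \<and> \<epsilon> > 0 \<and> uc_entourage X K \<epsilon> `` {F} \<subseteq> \<U>)"
proof -
  let ?P = "\<lambda>\<U> :: ('x \<Rightarrow> 'y set) set. \<U> \<subseteq> compact_valued X \<and>
     (\<forall>F\<in>\<U>. \<exists>K \<epsilon>. compactin X K \<and> \<epsilon> > 0 \<and> uc_entourage X K \<epsilon> `` {F} \<subseteq> \<U>)"
  have "istopology ?P"
    unfolding istopology_def
  proof (intro conjI allI impI)
    fix S T assume S: "?P S" and T: "?P T"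
    show "S \<inter> T \<subseteq> compact_valued X" using S by blast
    show "\<forall>F\<in>S \<inter> T. \<exists>K \<epsilon>. compactin X K \<and> \<epsilon> > 0 \<and> uc_entourage X K \<epsilon> `` {F} \<subseteq> S \<inter> T"
    proof
      fix F assume F: "F \<in> S \<inter> T"
      obtain K a where K: "compactin X K" "a > 0" "uc_entourage X K a `` {F} \<subseteq> S"
        using conjunct2[OF S] F by (meson IntD1)
      obtain L b where L: "compactin X L" "b > 0" "uc_entourage X L b `` {F} \<subseteq> T"
        using conjunct2[OF T] F by (meson IntD2)
      have KL: "compactin X (K \<union> L)" "min a b > 0"
        using K L by (simp_all add: compactin_Un)
      have "uc_entourage X (K \<union> L) (min a b) \<subseteq> uc_entourage X K a \<inter> uc_entourage X L b"
        by (auto simp: uc_entourage_def)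
      then have "uc_entourage X (K \<union> L) (min a b) `` {F} \<subseteq> S \<inter> T"
        using K(3) L(3) by (meson Image_mono Int_greatest le_inf_iff order_refl order_trans)
      with KL show "\<exists>K \<epsilon>. compactin X K \<and> \<epsilon> > 0 \<and> uc_entourage X K \<epsilon> `` {F} \<subseteq> S \<inter> T"
        by (intro exI conjI)
    qed
  next
    fix \<K> assume "\<forall>S\<in>\<K>. ?P S"
    note \<K> = this
    show "\<Union>\<K> \<subseteq> compact_valued X"
      using \<K> by (simp add: Union_least)
    show "\<forall>F\<in>\<Union>\<K>. \<exists>K \<epsilon>. compactin X K \<and> \<epsilon> > 0 \<and> uc_entourage X K \<epsilon> `` {F} \<subseteq> \<Union>\<K>"
    proof
      fix F assume "F \<in> \<Union>\<K>"
      then obtain S where S: "S \<in> \<K>" "F \<in> S" ..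
      then obtain K a where "compactin X K" "a > 0" "uc_entourage X K a `` {F} \<subseteq> S"
        using conjunct2[OF bspec[OF \<K> S(1)]] by (meson bspec)
      moreover have "S \<subseteq> \<Union>\<K>"
        using S(1) by (rule Union_upper)
      ultimately show "\<exists>K \<epsilon>. compactin X K \<and> \<epsilon> > 0 \<and> uc_entourage X K \<epsilon> `` {F} \<subseteq> \<Union>\<K>"
        by (meson subset_trans)
    qed
  qed
  then show ?thesis
    unfolding uc_topology_def by (simp only: topology_inverse')
qed

lemma topspace_uc_topology:
  fixes X :: "'x topology"
  shows "topspace (uc_topology X :: ('x \<Rightarrow> 'y::metric_space set) topology) = compact_valued X"
    (is "topspace ?T = ?C")
proof (rule subset_antisym)
  show "topspace ?T \<subseteq> ?C"
    using openin_topspace[of ?T] unfolding openin_uc_topology by (rule conjunct1)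
  have "uc_entourage X {} 1 `` {F} \<subseteq> ?C" for F
    by (auto simp: uc_entourage_def)
  moreover have "compactin X {}" "(1::real) > 0"
    by simp_all
  ultimately have "openin ?T ?C"
    unfolding openin_uc_topology by blast
  then show "?C \<subseteq> topspace ?T"
    by (rule openin_subset)
qed

lemma MC_subset_compact_valued: "MC X \<subseteq> compact_valued X"
proof
  fix F assume "F \<in> MC X"
  then have "F \<in> extensional (topspace X)" "usco X F"
    unfolding MC_def minimal_cusco_def cusco_def by simp_all
  then show "F \<in> compact_valued X"
    by (simp add: compact_valued_def usco_def PiE_iff)
qed

definition MC_uc ::
    "'x topology \<Rightarrow> ('x \<Rightarrow> 'y::{real_vector,metric_space} set) topology" where
  "MC_uc X = subtopology (uc_topology X) (MC X)"


section \<open>Topological properties\<close>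

definition frechet_urysohn :: "'a topology \<Rightarrow> bool" where
  "frechet_urysohn Z \<longleftrightarrow>
     (\<forall>E\<subseteq>topspace Z. \<forall>z\<in>Z closure_of E. \<exists>s. range s \<subseteq> E \<and> limitin Z s z sequentially)"

definition sequential :: "'a topology \<Rightarrow> bool" where
  "sequential Z \<longleftrightarrow>
     (\<forall>A\<subseteq>topspace Z. \<not> closedin Z A \<longrightarrow>
        (\<exists>s z. range s \<subseteq> A \<and> limitin Z s z sequentially \<and> z \<notin> A))"

definition countable_tightness :: "'a topology \<Rightarrow> bool" where
  "countable_tightness Z \<longleftrightarrow>
     (\<forall>A\<subseteq>topspace Z. \<forall>z\<in>Z closure_of A. \<exists>A\<^sub>0\<subseteq>A. countable A\<^sub>0 \<and> z \<in> Z closure_of A\<^sub>0)"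

definition hemicompact :: "'a topology \<Rightarrow> bool" where
  "hemicompact Z \<longleftrightarrow>
     (\<exists>\<K>\<subseteq>{K. compactin Z K \<and> K \<noteq> {}}. countable \<K> \<and>
        (\<forall>K. compactin Z K \<and> K \<noteq> {} \<longrightarrow> (\<exists>L\<in>\<K>. K \<subseteq> L)))"

end

theory Submission imports Defs
begin

text \<open>
  Only two of the implications concern multifunctions; the chain from first countability down to
  countable tightness holds in every topological space.

  If \<^term>\<open>X\<close> is hemicompact, a countable cofinal family \<^term>\<open>K 0\<close>, \<^term>\<open>K 1\<close>, \dots of compact
  sets yields the weight \<^term>\<open>w x = 1 / (n + 1)\<close>, where \<^term>\<open>n\<close> is the least index with
  \<^term>\<open>x \<in> K n\<close>, and \<^term>\<open>D F G = (SUP x\<in>topspace X. min (w x) (hausdorff_dist (F x) (G x)))\<close>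
  is a metric for uniform convergence on compact sets: a \<^term>\<open>D\<close>-ball of radius at most
  \<^term>\<open>1 / (n + 1)\<close> controls the distance on \<^term>\<open>K n\<close>, while the points at which the weight is not
  small already lie in a finite union of the \<^term>\<open>K n\<close>
  (\<open>metrizable_uc_topology_if_hemicompact\<close>).

  Conversely, fix a vector \<^term>\<open>v \<noteq> 0\<close>.  As \<^term>\<open>X\<close> is locally compact Hausdorff, each compact
  \<^term>\<open>K\<close> lies in an open set contained in a compact set \<^term>\<open>L\<close>, and some continuous real function
  \<^term>\<open>f\<close> vanishes on \<^term>\<open>K\<close> and equals \<^term>\<open>1\<close> off \<^term>\<open>L\<close>.  Continuous single-valued maps are
  minimal cusco, so the maps \<^term>\<open>\<lambda>x. {f x *\<^sub>R v}\<close> belong to the space, and the zero map is in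
  their closure because each of them vanishes on its \<^term>\<open>K\<close>.  If countably many of them suffice,
  the corresponding sets \<^term>\<open>L\<close> are cofinal: on a compact set \<^term>\<open>C\<close> one of these maps is closer
  to \<^term>\<open>0\<close> than \<^term>\<open>v\<close> is, hence never takes the value \<^term>\<open>v\<close> there, and \<^term>\<open>C \<subseteq> L\<close>
  (\<open>hemicompact_if_countable_tightness_MC_uc\<close>).
\<close>

section \<open>Sequential convergence properties\<close>

text \<open>
  The sequence is chosen in the finite intersections of a countable neighbourhood base, which
  decrease.
\<close>

lemma first_countable_imp_frechet_urysohn:
  assumes "first_countable Z"
  shows "frechet_urysohn Z"
  unfolding frechet_urysohn_def
proof (intro allI impI ballI)
  fix E z assume z: "z \<in> Z closure_of E"
  then have zZ: "z \<in> topspace Z"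
    by (simp add: in_closure_of)
  then obtain \<B> where \<B>: "countable \<B>" "\<forall>V\<in>\<B>. openin Z V"
    and base: "\<And>U. openin Z U \<Longrightarrow> z \<in> U \<Longrightarrow> \<exists>V\<in>\<B>. z \<in> V \<and> V \<subseteq> U"
    using assms unfolding first_countable_def by meson
  define \<C> where "\<C> = {V \<in> \<B>. z \<in> V}"
  have "\<C> \<noteq> {}"
    using base[OF openin_topspace zZ] by (auto simp: \<C>_def)
  moreover have "countable \<C>"
    using \<B>(1) by (auto simp: \<C>_def)
  ultimately have V: "range (from_nat_into \<C>) = \<C>"
    by (simp add: range_from_nat_into)
  define W where "W n = (\<Inter>i\<le>n. from_nat_into \<C> i)" for n :: nat
  have "from_nat_into \<C> i \<in> \<C>" for i
    using V by blast
  then have "openin Z (from_nat_into \<C> i) \<and> z \<in> from_nat_into \<C> i" for i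
    using \<B>(2) unfolding \<C>_def by blast
  then have "openin Z (W n)" "z \<in> W n" for n
    unfolding W_def by (auto intro!: openin_INT2)
  then have "\<exists>y. y \<in> E \<and> y \<in> W n" for n
    using z unfolding in_closure_of by blast
  then obtain s where s: "\<And>n. s n \<in> E" "\<And>n. s n \<in> W n"
    by metis
  have "limitin Z s z sequentially"
    unfolding limitin_sequentially
  proof (intro conjI allI impI)
    fix U assume "openin Z U \<and> z \<in> U"
    then obtain V where "V \<in> \<C>" "V \<subseteq> U"
      using base unfolding \<C>_def by blast
    then obtain N where "from_nat_into \<C> N \<subseteq> U"
      using V by (metis imageE)
    then have "s n \<in> U" if "N \<le> n" for n
      using s(2)[of n] that unfolding W_def by blast
    then show "\<exists>N. \<forall>n. N \<le> n \<longrightarrow> s n \<in> U"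
      by blast
  qed (rule zZ)
  then show "\<exists>s. range s \<subseteq> E \<and> limitin Z s z sequentially"
    using s(1) by blast
qed

lemma frechet_urysohn_imp_sequential:
  assumes "frechet_urysohn Z"
  shows "sequential Z"
  unfolding sequential_def
proof (intro allI impI)
  fix A assume A: "A \<subseteq> topspace Z" "\<not> closedin Z A"
  then have "\<not> Z closure_of A \<subseteq> A"
    by (metis closure_of_subset closure_of_eq subset_antisym)
  then obtain z where "z \<in> Z closure_of A" "z \<notin> A"
    by blast
  then show "\<exists>s z. range s \<subseteq> A \<and> limitin Z s z sequentially \<and> z \<notin> A"
    using assms A(1) unfolding frechet_urysohn_def by meson
qed

text \<open>
  The union of the closures of the countable subsets of a given set is closed under limits of
  sequences, because a sequence of its members involves countably many countable sets.
\<close>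

lemma sequential_imp_countable_tightness:
  assumes "sequential Z"
  shows "countable_tightness Z"
  unfolding countable_tightness_def
proof (intro allI impI ballI)
  fix A z assume A: "A \<subseteq> topspace Z" and z: "z \<in> Z closure_of A"
  define B where "B = (\<Union>A0\<in>{A0. A0 \<subseteq> A \<and> countable A0}. Z closure_of A0)"
  have "B \<subseteq> topspace Z"
    unfolding B_def using closure_of_subset_topspace by fast
  have "y \<in> B" if s: "range s \<subseteq> B" "limitin Z s y sequentially" for s y
  proof -
    have "\<exists>A0. A0 \<subseteq> A \<and> countable A0 \<and> s n \<in> Z closure_of A0" for n :: nat
      using s(1) unfolding B_def by blast
    then obtain A0 where A0: "\<And>n. A0 n \<subseteq> A" "\<And>n. countable (A0 n)" "\<And>n. s n \<in> Z closure_of A0 n"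
      by metis
    have "s n \<in> Z closure_of (\<Union>n. A0 n)" for n
      using A0(3)[of n] closure_of_mono[of "A0 n" "\<Union>n. A0 n" Z] by blast
    then have "y \<in> Z closure_of (\<Union>n. A0 n)"
      using limitin_closedin[OF s(2) closedin_closure_of] by simp
    moreover have "(\<Union>n. A0 n) \<subseteq> A" "countable (\<Union>n. A0 n)"
      using A0(1,2) by auto
    ultimately show ?thesis
      unfolding B_def by (intro UN_I[of "\<Union>n. A0 n"]) simp_all
  qed
  then have "closedin Z B"
    using assms \<open>B \<subseteq> topspace Z\<close> unfolding sequential_def by meson
  moreover have "A \<subseteq> B"
  proof
    fix a assume "a \<in> A"
    then have "a \<in> Z closure_of {a}"
      using A closure_of_subset[of "{a}" Z] by blast
    then show "a \<in> B"
      unfolding B_def using \<open>a \<in> A\<close> by (intro UN_I[of "{a}"]) simp_all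
  qed
  ultimately have "z \<in> B"
    using z closure_of_minimal by blast
  then show "\<exists>A0\<subseteq>A. countable A0 \<and> z \<in> Z closure_of A0"
    unfolding B_def by blast
qed


section \<open>The Hausdorff distance\<close>

lemma bdd_above_infdist_image:
  fixes A B :: "'a::metric_space set"
  assumes "bounded A"
  shows "bdd_above ((\<lambda>a. infdist a B) ` A)"
proof -
  obtain c e where "\<And>a. a \<in> A \<Longrightarrow> dist c a \<le> e"
    using assms unfolding bounded_def by blast
  then have "infdist a B \<le> infdist c B + e" if "a \<in> A" for a
    using infdist_triangle[of a B c] that by (force simp: dist_commute)
  then show ?thesis
    by (rule bdd_aboveI2)
qed

lemma hausdorff_dist_le_iff:
  fixes A B :: "'a::metric_space set"
  assumes "compact A" "A \<noteq> {}" "compact B" "B \<noteq> {}"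
  shows "hausdorff_dist A B \<le> r \<longleftrightarrow> (\<forall>a\<in>A. infdist a B \<le> r) \<and> (\<forall>b\<in>B. infdist b A \<le> r)"
  using assms
  by (simp add: hausdorff_dist_def cSUP_le_iff bdd_above_infdist_image compact_imp_bounded)

lemma hausdorff_dist_commute: "hausdorff_dist A B = hausdorff_dist B A"
  by (simp add: hausdorff_dist_def max.commute)

lemma hausdorff_dist_singleton [simp]: "hausdorff_dist {a} {b} = dist a b"
  by (simp add: hausdorff_dist_def dist_commute)

lemma infdist_le_hausdorff_dist:
  fixes A B :: "'a::metric_space set"
  assumes "compact A" "compact B" "B \<noteq> {}" "a \<in> A"
  shows "infdist a B \<le> hausdorff_dist A B"
  using hausdorff_dist_le_iff[of A B "hausdorff_dist A B"] assms by blast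

lemma hausdorff_dist_nonneg:
  fixes A B :: "'a::metric_space set"
  assumes "compact A" "A \<noteq> {}" "compact B" "B \<noteq> {}"
  shows "0 \<le> hausdorff_dist A B"
proof -
  obtain a where "a \<in> A"
    using assms(2) by blast
  then show ?thesis
    using infdist_le_hausdorff_dist[OF assms(1,3,4)] infdist_nonneg order_trans by blast
qed

lemma hausdorff_dist_eq_0_iff:
  fixes A B :: "'a::metric_space set"
  assumes "compact A" "A \<noteq> {}" "compact B" "B \<noteq> {}"
  shows "hausdorff_dist A B = 0 \<longleftrightarrow> A = B"
proof
  assume "hausdorff_dist A B = 0"
  then have "\<forall>a\<in>A. infdist a B \<le> 0" "\<forall>b\<in>B. infdist b A \<le> 0"
    using hausdorff_dist_le_iff[OF assms, of 0] by auto
  then have "\<forall>a\<in>A. infdist a B = 0" "\<forall>b\<in>B. infdist b A = 0"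
    using infdist_nonneg by (meson antisym)+
  then show "A = B"
    using assms in_closed_iff_infdist_zero compact_imp_closed by blast
next
  assume "A = B"
  then show "hausdorff_dist A B = 0"
    using assms hausdorff_dist_le_iff[of A A 0] hausdorff_dist_nonneg[of A A] by simp
qed

lemma infdist_le_infdist_plus_hausdorff_dist:
  fixes A B :: "'a::metric_space set"
  assumes "compact A" "A \<noteq> {}" "compact B" "B \<noteq> {}"
  shows "infdist x B \<le> infdist x A + hausdorff_dist A B"
proof -
  have "infdist x B - hausdorff_dist A B \<le> dist x a" if "a \<in> A" for a
    using infdist_triangle[of x B a] infdist_le_hausdorff_dist[OF assms(1,3,4) that] by linarith
  then have "infdist x B - hausdorff_dist A B \<le> infdist x A"
    unfolding infdist_notempty[OF assms(2)] using assms(2) by (intro cINF_greatest)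
  then show ?thesis
    by linarith
qed

lemma hausdorff_dist_triangle:
  fixes A B C :: "'a::metric_space set"
  assumes "compact A" "A \<noteq> {}" "compact B" "B \<noteq> {}" "compact C" "C \<noteq> {}"
  shows "hausdorff_dist A C \<le> hausdorff_dist A B + hausdorff_dist B C"
  unfolding hausdorff_dist_le_iff[OF assms(1,2,5,6)]
proof (intro conjI ballI)
  fix a assume "a \<in> A"
  then show "infdist a C \<le> hausdorff_dist A B + hausdorff_dist B C"
    using infdist_le_infdist_plus_hausdorff_dist[of B C a] infdist_le_hausdorff_dist[of A B a] assms
    by fastforce
next
  fix c assume "c \<in> C"
  then show "infdist c A \<le> hausdorff_dist A B + hausdorff_dist B C"
    using infdist_le_infdist_plus_hausdorff_dist[of B A c] infdist_le_hausdorff_dist[of C B c] assms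
    by (fastforce simp: hausdorff_dist_commute)
qed


section \<open>Hemicompact domains give a metrizable space\<close>

lemma compact_valuedD:
  assumes "F \<in> compact_valued X" "x \<in> topspace X"
  shows "compact (F x)" "F x \<noteq> {}"
  using assms by (auto simp: compact_valued_def PiE_iff)

text \<open>
  A single supremum over the whole space replaces the usual sum of truncated pseudometrics: the
  decaying weights are built into the truncation.  A metric on a carrier has to be nonnegative at all
  arguments, even at set-valued maps with unbounded values; the absolute value ensures this and
  changes nothing on the compact-valued maps.
\<close>

definition weighted_dist ::
    "'x topology \<Rightarrow> ('x \<Rightarrow> real) \<Rightarrow> ('x \<Rightarrow> 'y::metric_space set) \<Rightarrow> ('x \<Rightarrow> 'y set) \<Rightarrow> real" where
  "weighted_dist X w F G = (SUP x\<in>topspace X. min (w x) \<bar>hausdorff_dist (F x) (G x)\<bar>)"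

lemma weighted_dist_le_iff:
  assumes "topspace X \<noteq> {}" "\<And>x. w x \<le> 1"
  shows "weighted_dist X w F G \<le> r \<longleftrightarrow>
           (\<forall>x\<in>topspace X. min (w x) \<bar>hausdorff_dist (F x) (G x)\<bar> \<le> r)"
proof -
  have "bdd_above ((\<lambda>x. min (w x) \<bar>hausdorff_dist (F x) (G x)\<bar>) ` topspace X)"
    using assms(2) by (intro bdd_aboveI2[where M = 1]) (simp add: min.coboundedI1)
  then show ?thesis
    unfolding weighted_dist_def by (rule cSUP_le_iff[OF assms(1)])
qed

lemma Metric_space_weighted_dist:
  fixes X :: "'x topology" and w :: "'x \<Rightarrow> real"
  assumes X: "topspace X \<noteq> {}" and w: "\<And>x. 0 < w x" "\<And>x. w x \<le> 1"
  shows "Metric_space (compact_valued X :: ('x \<Rightarrow> 'y::metric_space set) set) (weighted_dist X w)"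
proof -
  define m where "m F G x = min (w x) \<bar>hausdorff_dist (F x) (G x)\<bar>" for F G :: "'x \<Rightarrow> 'y set" and x
  have le_iff: "weighted_dist X w F G \<le> r \<longleftrightarrow> (\<forall>x\<in>topspace X. m F G x \<le> r)"
    for F G :: "'x \<Rightarrow> 'y set" and r
    unfolding m_def by (rule weighted_dist_le_iff[OF X w(2)])
  have upper: "m F G x \<le> weighted_dist X w F G" if "x \<in> topspace X" for F G x
    using le_iff[of F G "weighted_dist X w F G"] that by blast
  have m_nonneg: "0 \<le> m F G x" for F G x
    using w(1)[of x] by (simp add: m_def)
  have nonneg: "0 \<le> weighted_dist X w F G" for F G :: "'x \<Rightarrow> 'y set"
    using m_nonneg upper X by (meson all_not_in_conv order_trans)
  show ?thesis
  proof
    fix F G :: "'x \<Rightarrow> 'y set"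
    show "0 \<le> weighted_dist X w F G"
      by (rule nonneg)
    show "weighted_dist X w F G = weighted_dist X w G F"
      by (simp add: weighted_dist_def hausdorff_dist_commute)
  next
    fix F G :: "'x \<Rightarrow> 'y set"
    assume FG: "F \<in> compact_valued X" "G \<in> compact_valued X"
    have "weighted_dist X w F G = 0 \<longleftrightarrow> weighted_dist X w F G \<le> 0"
      using nonneg[of F G] by linarith
    also have "\<dots> \<longleftrightarrow> (\<forall>x\<in>topspace X. hausdorff_dist (F x) (G x) = 0)"
      unfolding le_iff m_def by (simp add: min_le_iff_disj w(1)[folded not_le])
    also have "\<dots> \<longleftrightarrow> (\<forall>x\<in>topspace X. F x = G x)"
      using compact_valuedD[OF FG(1)] compact_valuedD[OF FG(2)]
      by (intro ball_cong refl hausdorff_dist_eq_0_iff)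
    also have "\<dots> \<longleftrightarrow> F = G"
      using PiE_ext[OF FG[unfolded compact_valued_def]] by blast
    finally show "weighted_dist X w F G = 0 \<longleftrightarrow> F = G" .
  next
    fix F G H :: "'x \<Rightarrow> 'y set"
    assume FGH: "F \<in> compact_valued X" "G \<in> compact_valued X" "H \<in> compact_valued X"
    show "weighted_dist X w F H \<le> weighted_dist X w F G + weighted_dist X w G H"
      unfolding le_iff
    proof
      fix x assume x: "x \<in> topspace X"
      note cv = compact_valuedD[OF FGH(1) x] compact_valuedD[OF FGH(2) x] compact_valuedD[OF FGH(3) x]
      have "\<bar>hausdorff_dist (F x) (H x)\<bar> \<le>
              \<bar>hausdorff_dist (F x) (G x)\<bar> + \<bar>hausdorff_dist (G x) (H x)\<bar>"
        using hausdorff_dist_triangle[OF cv] hausdorff_dist_nonneg[of "F x" "H x"] cv by linarith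
      then have "m F H x \<le> m F G x + m G H x"
        using w(1)[of x] unfolding m_def by linarith
      then show "m F H x \<le> weighted_dist X w F G + weighted_dist X w G H"
        using upper[OF x, of F G] upper[OF x, of G H] by linarith
    qed
  qed
qed

text \<open>
  The two topologies agree when the points of each compact set have weights bounded away from zero,
  while the points with weight at least \<^term>\<open>e\<close> are confined to a compact set.
\<close>

lemma uc_topology_eq_mtopology_weighted_dist:
  fixes X :: "'x topology" and w :: "'x \<Rightarrow> real"
  assumes X: "topspace X \<noteq> {}" and w: "\<And>x. 0 < w x" "\<And>x. w x \<le> 1"
    and bounded_below: "\<And>K. compactin X K \<Longrightarrow> \<exists>e>0. \<forall>x\<in>K. e \<le> w x"
    and vanishing: "\<And>e. 0 < e \<Longrightarrow> \<exists>K. compactin X K \<and> (\<forall>x\<in>topspace X - K. w x < e)"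
  shows "(uc_topology X :: ('x \<Rightarrow> 'y::metric_space set) topology) =
           Metric_space.mtopology (compact_valued X) (weighted_dist X w)"
proof -
  interpret Metric_space "compact_valued X :: ('x \<Rightarrow> 'y set) set" "weighted_dist X w"
    by (rule Metric_space_weighted_dist[OF X w])
  have le_iff: "weighted_dist X w F G \<le> r \<longleftrightarrow>
      (\<forall>x\<in>topspace X. min (w x) \<bar>hausdorff_dist (F x) (G x)\<bar> \<le> r)"
    for F G :: "'x \<Rightarrow> 'y set" and r
    by (rule weighted_dist_le_iff[OF X w(2)])
  have ball_in_entourage: "\<exists>r>0. mball F r \<subseteq> uc_entourage X K \<epsilon> `` {F}"
    if F: "F \<in> compact_valued X" and K: "compactin X K" and \<epsilon>: "\<epsilon> > 0"
    for F :: "'x \<Rightarrow> 'y set" and K \<epsilon>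
  proof -
    obtain e where e: "e > 0" "\<And>x. x \<in> K \<Longrightarrow> e \<le> w x"
      using bounded_below[OF K] by blast
    have "hausdorff_dist (F x) (G x) < \<epsilon>" if "G \<in> mball F (min e \<epsilon>)" "x \<in> K" for G x
    proof -
      have "x \<in> topspace X"
        using K \<open>x \<in> K\<close> compactin_subset_topspace by blast
      then have "min (w x) \<bar>hausdorff_dist (F x) (G x)\<bar> \<le> weighted_dist X w F G"
        using le_iff[of F G "weighted_dist X w F G"] by blast
      also have "\<dots> < min e \<epsilon>"
        using that by simp
      finally show ?thesis
        using e(2)[OF \<open>x \<in> K\<close>] by linarith
    qed
    then have "mball F (min e \<epsilon>) \<subseteq> uc_entourage X K \<epsilon> `` {F}"
      by (auto simp: uc_entourage_def)
    then show ?thesis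
      using e(1) \<epsilon> by (intro exI[of _ "min e \<epsilon>"]) simp
  qed
  have entourage_in_ball: "\<exists>K \<epsilon>. compactin X K \<and> \<epsilon> > 0 \<and> uc_entourage X K \<epsilon> `` {F} \<subseteq> mball F r"
    if F: "F \<in> compact_valued X" and r: "r > 0" for F :: "'x \<Rightarrow> 'y set" and r
  proof -
    obtain K where K: "compactin X K" "\<And>x. x \<in> topspace X - K \<Longrightarrow> w x < r / 2"
      using vanishing[of "r / 2"] r by auto
    have "G \<in> mball F r" if G: "G \<in> uc_entourage X K (r / 2) `` {F}" for G
    proof -
      have GC: "G \<in> compact_valued X" and GK: "\<And>x. x \<in> K \<Longrightarrow> hausdorff_dist (F x) (G x) < r / 2"
        using G by (auto simp: uc_entourage_def)
      have "min (w x) \<bar>hausdorff_dist (F x) (G x)\<bar> \<le> r / 2" if x: "x \<in> topspace X" for x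
      proof (cases "x \<in> K")
        case True
        have "0 \<le> hausdorff_dist (F x) (G x)"
          using compact_valuedD[OF F x] compact_valuedD[OF GC x] by (rule hausdorff_dist_nonneg)
        then show ?thesis
          using GK[OF True] by linarith
      next
        case False
        then show ?thesis
          using K(2)[of x] x by (simp add: min_le_iff_disj)
      qed
      then have "weighted_dist X w F G \<le> r / 2"
        unfolding le_iff by blast
      then show ?thesis
        using F GC r by simp
    qed
    then show ?thesis
      using K(1) r by (intro exI[of _ K] exI[of _ "r / 2"]) auto
  qed
  show ?thesis
    unfolding topology_eq openin_uc_topology openin_mtopology
  proof (intro allI conj_cong refl iffI ballI impI)
    fix \<U> and F :: "'x \<Rightarrow> 'y set"
    assume sub: "\<U> \<subseteq> compact_valued X" and "F \<in> \<U>"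
      and "\<forall>F\<in>\<U>. \<exists>K \<epsilon>. compactin X K \<and> \<epsilon> > 0 \<and> uc_entourage X K \<epsilon> `` {F} \<subseteq> \<U>"
    then obtain K \<epsilon> where "compactin X K" "\<epsilon> > 0" "uc_entourage X K \<epsilon> `` {F} \<subseteq> \<U>"
      by meson
    then show "\<exists>r>0. mball F r \<subseteq> \<U>"
      using ball_in_entourage[of F K \<epsilon>] sub \<open>F \<in> \<U>\<close> by (meson subset_trans subsetD)
  next
    fix \<U> and F :: "'x \<Rightarrow> 'y set"
    assume sub: "\<U> \<subseteq> compact_valued X" and "F \<in> \<U>"
      and "\<forall>F. F \<in> \<U> \<longrightarrow> (\<exists>r>0. mball F r \<subseteq> \<U>)"
    then obtain r where "r > 0" "mball F r \<subseteq> \<U>"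
      by meson
    then show "\<exists>K \<epsilon>. compactin X K \<and> \<epsilon> > 0 \<and> uc_entourage X K \<epsilon> `` {F} \<subseteq> \<U>"
      using entourage_in_ball[of F r] sub \<open>F \<in> \<U>\<close> by (meson subset_trans subsetD)
  qed
qed

theorem metrizable_uc_topology_if_hemicompact:
  fixes X :: "'x topology"
  assumes X: "topspace X \<noteq> {}" and hemi: "hemicompact X"
  shows "metrizable_space (uc_topology X :: ('x \<Rightarrow> 'y::metric_space set) topology)"
proof -
  obtain \<K> where \<K>: "\<K> \<subseteq> {K. compactin X K \<and> K \<noteq> {}}" "countable \<K>"
    and cofinal: "\<And>K. compactin X K \<Longrightarrow> K \<noteq> {} \<Longrightarrow> \<exists>L\<in>\<K>. K \<subseteq> L"
    using hemi unfolding hemicompact_def by meson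
  have covered: "\<exists>L\<in>\<K>. x \<in> L" if "x \<in> topspace X" for x
    using cofinal[of "{x}"] that by simp
  then have "\<K> \<noteq> {}"
    using X by blast
  define K where "K = from_nat_into \<K>"
  have range_K: "range K = \<K>"
    unfolding K_def using \<open>\<K> \<noteq> {}\<close> \<K>(2) by (rule range_from_nat_into)
  have K: "compactin X (K n)" for n
    using range_K \<K>(1) by blast
  define rank where "rank x = (LEAST n. x \<in> K n)" for x
  have rank_le: "rank x \<le> n" if "x \<in> K n" for x n
    unfolding rank_def using that by (rule Least_le)
  have in_rank: "x \<in> K (rank x)" if "x \<in> topspace X" for x
  proof -
    have "\<exists>n. x \<in> K n"
      using covered[OF that] range_K by (metis imageE)
    then show ?thesis
      unfolding rank_def by (rule LeastI_ex)
  qed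
  define w where "w x = inverse (real (Suc (rank x)))" for x
  have "uc_topology X = Metric_space.mtopology (compact_valued X :: ('x \<Rightarrow> 'y set) set) (weighted_dist X w)"
  proof (rule uc_topology_eq_mtopology_weighted_dist[OF X])
    show "0 < w x" "w x \<le> 1" for x
      by (simp_all add: w_def inverse_le_1_iff)
  next
    fix C assume C: "compactin X C"
    show "\<exists>e>0. \<forall>x\<in>C. e \<le> w x"
    proof (cases "C = {}")
      case True
      then show ?thesis
        by (auto intro: exI[of _ 1])
    next
      case False
      then obtain n where "C \<subseteq> K n"
        using cofinal[OF C] range_K by (metis imageE)
      then have "\<forall>x\<in>C. inverse (real (Suc n)) \<le> w x"
        unfolding w_def using rank_le by (auto intro!: le_imp_inverse_le)
      then show ?thesis
        by (intro exI[of _ "inverse (real (Suc n))"]) simp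
    qed
  next
    fix e :: real assume "0 < e"
    then obtain n where n: "inverse (real (Suc n)) < e"
      using reals_Archimedean by blast
    have "w x < e" if x: "x \<in> topspace X - (\<Union>i\<le>n. K i)" for x
    proof -
      have "n < rank x"
        using in_rank[of x] x by (metis DiffD1 DiffD2 UN_I atMost_iff not_le)
      then have "w x \<le> inverse (real (Suc n))"
        unfolding w_def by (auto intro!: le_imp_inverse_le)
      then show ?thesis
        using n by linarith
    qed
    moreover have "compactin X (\<Union>i\<le>n. K i)"
      using K by (intro compactin_Union) auto
    ultimately show "\<exists>C. compactin X C \<and> (\<forall>x\<in>topspace X - C. w x < e)"
      by blast
  qed
  moreover have "Metric_space (compact_valued X :: ('x \<Rightarrow> 'y set) set) (weighted_dist X w)"
    by (rule Metric_space_weighted_dist[OF X]) (simp_all add: w_def inverse_le_1_iff)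
  ultimately show ?thesis
    unfolding metrizable_space_def by blast
qed


section \<open>Countable tightness forces hemicompactness\<close>

text \<open>
  The strict inequality at every point need not define an open set, since the supremum over the
  compact set may reach the radius; a uniform bound below the radius does.
\<close>

lemma uc_entourage_contains_open:
  fixes F :: "'x \<Rightarrow> 'y::metric_space set"
  assumes F: "F \<in> compact_valued X" and K: "compactin X K" and \<epsilon>: "\<epsilon> > 0"
  obtains \<U> where "openin (uc_topology X) \<U>" "F \<in> \<U>" "\<U> \<subseteq> uc_entourage X K \<epsilon> `` {F}"
proof
  let ?U = "{G \<in> compact_valued X. \<exists>r<\<epsilon>. \<forall>x\<in>K. hausdorff_dist (F x) (G x) \<le> r}"
  have sub: "K \<subseteq> topspace X"
    using K by (rule compactin_subset_topspace)
  show "openin (uc_topology X) ?U"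
    unfolding openin_uc_topology
  proof (intro conjI ballI)
    fix G assume "G \<in> ?U"
    then obtain r where G: "G \<in> compact_valued X" and r: "r < \<epsilon>"
      and Gr: "\<And>x. x \<in> K \<Longrightarrow> hausdorff_dist (F x) (G x) \<le> r"
      by blast
    define \<delta> where "\<delta> = (\<epsilon> - r) / 2"
    have "H \<in> ?U" if H: "H \<in> uc_entourage X K \<delta> `` {G}" for H
    proof -
      have HC: "H \<in> compact_valued X" and HK: "\<And>x. x \<in> K \<Longrightarrow> hausdorff_dist (G x) (H x) < \<delta>"
        using H by (auto simp: uc_entourage_def)
      have "hausdorff_dist (F x) (H x) \<le> r + \<delta>" if x: "x \<in> K" for x
      proof -
        have "x \<in> topspace X"
          using x sub by blast
        then have "hausdorff_dist (F x) (H x) \<le>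
            hausdorff_dist (F x) (G x) + hausdorff_dist (G x) (H x)"
          using F G HC by (intro hausdorff_dist_triangle) (auto dest: compact_valuedD)
        then show ?thesis
          using Gr[OF x] HK[OF x] by linarith
      qed
      moreover have "r + \<delta> < \<epsilon>"
        using r by (simp add: \<delta>_def field_simps)
      ultimately show ?thesis
        using HC by blast
    qed
    moreover have "\<delta> > 0"
      using r by (simp add: \<delta>_def)
    ultimately show "\<exists>K \<epsilon>. compactin X K \<and> \<epsilon> > 0 \<and> uc_entourage X K \<epsilon> `` {G} \<subseteq> ?U"
      using K by blast
  qed blast
  have "hausdorff_dist (F x) (F x) = 0" if "x \<in> K" for x
    using hausdorff_dist_eq_0_iff[of "F x" "F x"] compact_valuedD[OF F, of x] sub that by blast
  then show "F \<in> ?U"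
    using F \<epsilon> by auto
  show "?U \<subseteq> uc_entourage X K \<epsilon> `` {F}"
    using F by (fastforce simp: uc_entourage_def)
qed

text \<open>
  A cusco map inside the graph of a single-valued map has nonempty values there, so it has the same
  graph.
\<close>

lemma continuous_single_valued_in_MC:
  fixes g :: "'x \<Rightarrow> 'y::{real_vector,metric_space}"
  assumes g: "continuous_map X euclidean g"
  shows "(\<lambda>x\<in>topspace X. {g x}) \<in> MC X"
proof -
  let ?F = "\<lambda>x\<in>topspace X. {g x}"
  have "upper_semicontinuous X ?F"
    unfolding upper_semicontinuous_def
  proof (intro ballI allI impI)
    fix x V assume x: "x \<in> topspace X" and V: "open V \<and> ?F x \<subseteq> V"
    let ?U = "{u \<in> topspace X. g u \<in> V}"
    have "openin X ?U"
      using openin_continuous_map_preimage[OF g] V by simp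
    moreover have "x \<in> ?U" "(\<Union>u\<in>?U. ?F u) \<subseteq> V"
      using x V by auto
    ultimately show "\<exists>U. openin X U \<and> x \<in> U \<and> (\<Union>u\<in>U. ?F u) \<subseteq> V"
      by blast
  qed
  then have "cusco X ?F"
    by (simp add: cusco_def usco_def)
  moreover have "\<not> Sigma (topspace X) G \<subset> Sigma (topspace X) ?F" if G: "cusco X G" for G
  proof
    assume less: "Sigma (topspace X) G \<subset> Sigma (topspace X) ?F"
    have "G x = ?F x" if "x \<in> topspace X" for x
    proof -
      have "G x \<noteq> {}" "G x \<subseteq> {g x}"
        using G less that by (auto simp: cusco_def usco_def)
      then show ?thesis
        using that by auto
    qed
    then show False
      using less by (metis Sigma_cong psubsetE)
  qed
  ultimately show ?thesis
    unfolding MC_def minimal_cusco_def by auto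
qed

text \<open>
  Continuity of the line through \<^term>\<open>v\<close> makes \<^term>\<open>\<lambda>x. f x *\<^sub>R v\<close> continuous for each real
  Urysohn function \<^term>\<open>f\<close>.  The sets indexing the family of maps may include the empty set, so an
  empty member has to be dropped from the cofinal family in the end.
\<close>

theorem hemicompact_if_countable_tightness_MC_uc:
  fixes X :: "'x topology" and v :: "'y::{real_vector,metric_space}"
  assumes lc: "locally_compact_space X" and haus: "Hausdorff_space X"
    and v: "v \<noteq> 0" and line: "continuous_on UNIV (\<lambda>r::real. r *\<^sub>R v)"
    and tight: "countable_tightness (MC_uc X :: ('x \<Rightarrow> 'y set) topology)"
  shows "hemicompact X"
proof -
  let ?Z = "MC_uc X :: ('x \<Rightarrow> 'y set) topology"
  define \<Phi> where "\<Phi> f = (\<lambda>x\<in>topspace X. {f x *\<^sub>R v})" for f :: "'x \<Rightarrow> real"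
  have \<Phi>_MC: "\<Phi> f \<in> MC X" if "continuous_map X euclideanreal f" for f
  proof -
    have "continuous_map euclidean euclidean (\<lambda>r::real. r *\<^sub>R v)"
      using line by simp
    from continuous_map_compose[OF that this]
    have "continuous_map X euclidean (\<lambda>x. f x *\<^sub>R v)"
      by (simp only: o_def)
    then show ?thesis
      unfolding \<Phi>_def by (rule continuous_single_valued_in_MC)
  qed
  have MC_cv: "MC X \<subseteq> (compact_valued X :: ('x \<Rightarrow> 'y set) set)"
    by (rule MC_subset_compact_valued)
  have topspace_Z: "topspace ?Z = MC X"
    using MC_cv by (auto simp: MC_uc_def topspace_uc_topology)

  have "\<exists>L f. compactin X L \<and> continuous_map X euclideanreal f \<and>
              (\<forall>x\<in>K. f x = 0) \<and> (\<forall>x\<in>topspace X - L. f x = 1)" if K: "compactin X K" for K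
  proof -
    obtain U L where U: "openin X U" "K \<subseteq> U" and L: "compactin X L" "U \<subseteq> L"
      using lc haus locally_compact_space_compact_closed_compact K by metis
    have "completely_regular_space X"
      using lc haus by (simp add: locally_compact_regular_imp_completely_regular_space)
    moreover have "closedin X (topspace X - U)" "disjnt K (topspace X - U)"
      using U by (auto simp: disjnt_iff)
    ultimately obtain f where f: "continuous_map X euclideanreal f"
        "f ` (topspace X - U) \<subseteq> {1}" "f ` K \<subseteq> {0}"
      using Urysohn_completely_regular_compact_closed_alt[of X K "topspace X - U" 1 0] K by metis
    have "\<forall>x\<in>K. f x = 0" "\<forall>x\<in>topspace X - L. f x = 1"
      using f(2,3) L(2) by blast+
    then show ?thesis
      using L(1) f(1) by blast
  qed
  then obtain L f where L: "\<And>K. compactin X K \<Longrightarrow> compactin X (L K)"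
    and f: "\<And>K. compactin X K \<Longrightarrow> continuous_map X euclideanreal (f K)"
    and f0: "\<And>K x. compactin X K \<Longrightarrow> x \<in> K \<Longrightarrow> f K x = 0"
    and f1: "\<And>K x. compactin X K \<Longrightarrow> x \<in> topspace X - L K \<Longrightarrow> f K x = 1"
    by metis

  let ?O = "\<Phi> (\<lambda>x. 0)"
  have O: "?O \<in> MC X"
    by (rule \<Phi>_MC) simp
  define \<A> where "\<A> = (\<lambda>K. \<Phi> (f K)) ` {K. compactin X K}"
  have \<A>_MC: "\<A> \<subseteq> MC X"
    unfolding \<A>_def using \<Phi>_MC f by blast
  have "?O \<in> ?Z closure_of \<A>"
    unfolding in_closure_of topspace_Z
  proof (intro conjI allI impI O)
    fix T assume T: "?O \<in> T \<and> openin ?Z T"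
    then obtain \<U> where \<U>: "openin (uc_topology X) \<U>" "T = \<U> \<inter> MC X"
      unfolding MC_uc_def openin_subtopology by blast
    then obtain K \<epsilon> where K: "compactin X K" "\<epsilon> > 0" "uc_entourage X K \<epsilon> `` {?O} \<subseteq> \<U>"
      using T unfolding openin_uc_topology by blast
    have "hausdorff_dist (?O x) (\<Phi> (f K) x) < \<epsilon>" if "x \<in> K" for x
      using that f0[OF K(1) that] K(2) compactin_subset_topspace[OF K(1)] by (auto simp: \<Phi>_def)
    then have "\<Phi> (f K) \<in> \<U>"
      using K(3) O \<Phi>_MC[OF f[OF K(1)]] MC_cv by (auto simp: uc_entourage_def)
    then show "\<exists>G. G \<in> \<A> \<and> G \<in> T"
      using \<U>(2) K(1) \<Phi>_MC[OF f[OF K(1)]] unfolding \<A>_def by blast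
  qed
  then obtain \<A>0 where "\<A>0 \<subseteq> \<A>" "countable \<A>0" and O_closure: "?O \<in> ?Z closure_of \<A>0"
    using tight \<A>_MC unfolding countable_tightness_def topspace_Z by meson
  then obtain \<K> where \<K>: "countable \<K>" "\<K> \<subseteq> {K. compactin X K}" "\<A>0 = (\<lambda>K. \<Phi> (f K)) ` \<K>"
    unfolding \<A>_def by (metis countable_subset_image)

  have cofinal: "\<exists>K\<in>\<K>. C \<subseteq> L K" if C: "compactin X C" for C
  proof -
    have "dist 0 v > 0"
      using v by simp
    then obtain \<U> where \<U>: "openin (uc_topology X) \<U>" "?O \<in> \<U>"
        "\<U> \<subseteq> uc_entourage X C (dist 0 v) `` {?O}"
      using uc_entourage_contains_open[OF _ C] O MC_cv by blast
    then have "openin ?Z (\<U> \<inter> MC X)" "?O \<in> \<U> \<inter> MC X"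
      using O unfolding MC_uc_def openin_subtopology by blast+
    then obtain G where "G \<in> \<A>0" "G \<in> \<U>"
      using O_closure unfolding in_closure_of by blast
    then obtain K where K: "K \<in> \<K>" "\<Phi> (f K) \<in> \<U>"
      using \<K>(3) by blast
    have "x \<in> L K" if x: "x \<in> C" for x
    proof (rule ccontr)
      assume "x \<notin> L K"
      have "x \<in> topspace X"
        using x compactin_subset_topspace[OF C] by blast
      then have "f K x = 1"
        using f1[of K x] K(1) \<K>(2) \<open>x \<notin> L K\<close> by blast
      moreover have "hausdorff_dist (?O x) (\<Phi> (f K) x) < dist 0 v"
        using K(2) \<U>(3) x by (auto simp: uc_entourage_def)
      ultimately show False
        using \<open>x \<in> topspace X\<close> by (simp add: \<Phi>_def)
    qed
    then show ?thesis
      using K(1) by blast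
  qed

  show ?thesis
    unfolding hemicompact_def
  proof (intro exI conjI allI impI)
    show "L ` \<K> - {{}} \<subseteq> {K. compactin X K \<and> K \<noteq> {}}"
      using L \<K>(2) by auto
    show "countable (L ` \<K> - {{}})"
      using \<K>(1) by simp
    show "\<exists>M\<in>L ` \<K> - {{}}. C \<subseteq> M" if "compactin X C \<and> C \<noteq> {}" for C
      using cofinal[of C] that by blast
  qed
qed


section \<open>The equivalence\<close>

lemma (in locally_convex_tvs) continuous_on_scaleR_left:
  fixes y :: 'y
  shows "continuous_on UNIV (\<lambda>r::real. r *\<^sub>R y)"
proof -
  have "continuous_on UNIV (\<lambda>r::real. (\<lambda>(c, y). scale c y) (of_real r, y))"
    by (intro continuous_on_compose2[OF continuous_scale] continuous_intros) auto
  then show ?thesis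
    by (simp add: scale_of_real)
qed

theorem corollary4p5:
  fixes X :: "'x topology"
    and scale :: "'k::real_normed_field \<Rightarrow> 'y::{real_vector,metric_space} \<Rightarrow> 'y"
  assumes "topspace X \<noteq> {}"
    and "locally_compact_space X"
    and "Hausdorff_space X"
    and "locally_convex_tvs scale"
    and "\<exists>a b::'y. a \<noteq> b"
  shows "let Z = (MC_uc X :: ('x \<Rightarrow> 'y set) topology) in
           (metrizable_space Z \<longleftrightarrow> first_countable Z)
         \<and> (first_countable Z \<longleftrightarrow> frechet_urysohn Z)
         \<and> (frechet_urysohn Z \<longleftrightarrow> sequential Z)
         \<and> (sequential Z \<longleftrightarrow> countable_tightness Z)
         \<and> (countable_tightness Z \<longleftrightarrow> hemicompact X)"
proof -
  let ?Z = "MC_uc X :: ('x \<Rightarrow> 'y set) topology"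
  obtain a b :: 'y where "a \<noteq> b"
    using assms(5) by blast
  then have "a - b \<noteq> 0"
    by simp
  then have "countable_tightness ?Z \<Longrightarrow> hemicompact X"
    using hemicompact_if_countable_tightness_MC_uc[OF assms(2,3)]
      locally_convex_tvs.continuous_on_scaleR_left[OF assms(4)] by blast
  moreover have "hemicompact X \<Longrightarrow> metrizable_space ?Z"
    unfolding MC_uc_def
    by (intro metrizable_space_subtopology metrizable_uc_topology_if_hemicompact assms(1))
  ultimately show ?thesis
    unfolding Let_def
    using metrizable_imp_first_countable[of ?Z] first_countable_imp_frechet_urysohn[of ?Z]
      frechet_urysohn_imp_sequential[of ?Z] sequential_imp_countable_tightness[of ?Z] by blast
qed

end
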